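(* Let $q\ge5$ be a power of $3$. Then every $\Gamma$-plane contains the axis $\mathrm{A}$ (so $\Lambda_{\mathrm{A},\Gamma}=1$ and $\Pi_{\Gamma,\mathrm{A}}=q+1$), and $\mathrm{A}$ is contained in no $2_{\mathcal C}$-, $3_{\mathcal C}$-, $\overline{1_{\mathcal C}}$- or $0_{\mathcal C}$-plane. Moreover $\Lambda_{\mathrm{EA},\Gamma}=q^2-1$ and $\Pi_{\Gamma,\mathrm{EA}}=1$.
   Context: Let $\mathrm{PG}(3,q)$ have points $\mathbf{P}(x_0,x_1,x_2,x_3)$; put $P(t)=\mathbf{P}(t^3,t^2,t,1)$ ($t\in\mathbb{F}_q$), $P(\infty)=\mathbf{P}(1,0,0,0)$, $\mathcal{C}=\{P(t):t\in\mathbb{F}_q\cup\{\infty\}\}$ the twisted cubic, $G_q$ the group of projectivities fixing $\mathcal C$. Write $\boldsymbol{\pi}(c_0,c_1,c_2,c_3)$ for the plane $c_0x_0+c_1x_1+c_2x_2+c_3x_3=0$. $\Gamma$-planes: the osculating planes $\boldsymbol{\pi}(1,-3t,3t^2,-t^3)$ ($t\in\mathbb{F}_q$) and $\boldsymbol{\pi}(0,0,0,1)$. For $q\equiv0\pmod3$ all $\Gamma$-planes pass through a common line, the axis $\mathrm{A}$. A $d_{\mathcal C}$-plane ($d\in\{0,2,3\}$) contains exactly $d$ points of $\mathcal C$; a $\overline{1_{\mathcal C}}$-plane is a non-$\Gamma$-plane with exactly one point of $\mathcal C$. An EA-line is a line containing no point of $\mathcal C$, different from $\mathrm{A}$, that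 meets $\mathrm{A}$. Notation: $\Lambda_{\lambda,\pi}$ is the number of $\lambda$-lines in a $\pi$-plane; $\Pi_{\pi,\lambda}$ is the average, over all $\lambda$-lines, of the number of $\pi$-planes through the line. *)

theory Defs
  imports "HOL-Analysis.Analysis"
begin

text \<open>Points, lines and planes of PG(3,q) are the linear subspaces of vector space
  dimension 1, 2, 3 of the coordinate space over a field; incidence is inclusion.
  In the index type 4 one has 4 = 0, so the four indices can be written 0, 1, 2, 3.\<close>

type_synonym 'a vec4 = "'a ^ 4"

definition mk_vec :: "'a \<Rightarrow> 'a \<Rightarrow> 'a \<Rightarrow> 'a \<Rightarrow> 'a vec4" where
  "mk_vec a b c d = (\<chi> i. if i = 0 then a else if i = 1 then b else if i = 2 then c else d)"

definition points :: "'a::field vec4 set set" where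
  "points = {p. vec.subspace p \<and> vec.dim p = 1}"

definition lines :: "'a::field vec4 set set" where
  "lines = {l. vec.subspace l \<and> vec.dim l = 2}"

definition planes :: "'a::field vec4 set set" where
  "planes = {E. vec.subspace E \<and> vec.dim E = 3}"

definition pt :: "'a::field \<Rightarrow> 'a \<Rightarrow> 'a \<Rightarrow> 'a \<Rightarrow> 'a vec4 set" where
  "pt x0 x1 x2 x3 = vec.span {mk_vec x0 x1 x2 x3}"

definition pl :: "'a::field \<Rightarrow> 'a \<Rightarrow> 'a \<Rightarrow> 'a \<Rightarrow> 'a vec4 set" where
  "pl c0 c1 c2 c3 = {x. c0 * x$0 + c1 * x$1 + c2 * x$2 + c3 * x$3 = 0}"

definition twisted_cubic :: "'a::field vec4 set set" where
  "twisted_cubic = insert (pt 1 0 0 0) (range (\<lambda>t. pt (t ^ 3) (t ^ 2) t 1))"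

definition Gamma_planes :: "'a::field vec4 set set" where
  "Gamma_planes =
     insert (pl 0 0 0 1) (range (\<lambda>t. pl 1 (- 3 * t) (3 * t ^ 2) (- (t ^ 3))))"

definition cubic_planes :: "nat \<Rightarrow> 'a::field vec4 set set" where
  "cubic_planes d = {E \<in> planes. card {p \<in> twisted_cubic. p \<subseteq> E} = d}"

definition one_bar_planes :: "'a::field vec4 set set" where
  "one_bar_planes = cubic_planes 1 - Gamma_planes"

text \<open>Only meaningful in characteristic 3, where the line is unique (see below).\<close>

definition Gamma_axis :: "'a::field vec4 set" where
  "Gamma_axis = (THE l. l \<in> lines \<and> (\<forall>E \<in> Gamma_planes. l \<subseteq> E))"

definition EA_lines :: "'a::field vec4 set set" where
  "EA_lines = {l \<in> lines. (\<forall>p \<in> twisted_cubic. \<not> p \<subseteq> l) \<and> l \<noteq> Gamma_axis \<and>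
     (\<exists>p \<in> points. p \<subseteq> l \<and> p \<subseteq> Gamma_axis)}"

definition Lambda :: "'a::field vec4 set set \<Rightarrow> 'a vec4 set \<Rightarrow> nat" where
  "Lambda L E = card {l \<in> L. l \<subseteq> E}"

definition Pi_avg :: "'a::field vec4 set set \<Rightarrow> 'a vec4 set set \<Rightarrow> real" where
  "Pi_avg S L = (\<Sum>l\<in>L. real (card {E \<in> S. l \<subseteq> E})) / real (card L)"

lemma index_4_distinct [simp]:
  "(0::4) \<noteq> 1" "(0::4) \<noteq> 2" "(0::4) \<noteq> 3" "(1::4) \<noteq> 2" "(1::4) \<noteq> 3" "(2::4) \<noteq> 3"
  by simp_all

lemma all_index_4: "(\<forall>i::4. P i) \<longleftrightarrow> P 0 \<and> P 1 \<and> P 2 \<and> P 3"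
proof -
  have "(4::4) = 0" by simp
  then show ?thesis unfolding forall_4 by metis
qed

lemma Gamma_axis_char_3:
  assumes "(3::'a::field) = 0"
  shows "\<exists>!l::'a vec4 set. l \<in> lines \<and> (\<forall>E \<in> Gamma_planes. l \<subseteq> E)"
    and "(Gamma_axis::'a vec4 set) \<in> lines"
    and "(Gamma_axis::'a vec4 set) = {x. x$0 = 0 \<and> x$3 = 0}"
proof -
  define A :: "'a vec4 set" where "A = {x. x$0 = 0 \<and> x$3 = 0}"
  have A_alt: "A = {x. \<forall>i. i \<notin> {1,2} \<longrightarrow> x$i = 0}"
    by (auto simp: A_def all_index_4)
  have sub: "vec.subspace A"
    by (auto simp: A_def vec.subspace_def)
  have "vec.dim A = card {1, 2 :: 4}"
    unfolding A_alt by (rule dim_substandard_cart)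
  then have dim: "vec.dim A = 2" by simp
  have G: "(\<forall>E \<in> Gamma_planes. l \<subseteq> E) \<longleftrightarrow> l \<subseteq> A" for l :: "'a vec4 set"
  proof
    assume l: "\<forall>E \<in> Gamma_planes. l \<subseteq> E"
    have "l \<subseteq> pl 0 0 0 1"
      using l by (simp add: Gamma_planes_def)
    moreover have "pl 1 (- 3 * 0) (3 * 0 ^ 2) (- (0 ^ 3)) \<in> (Gamma_planes :: 'a vec4 set set)"
      unfolding Gamma_planes_def by blast
    with l have "l \<subseteq> pl 1 (- 3 * 0) (3 * 0 ^ 2) (- (0 ^ 3))" by blast
    ultimately show "l \<subseteq> A"
      by (auto simp: pl_def A_def)
  next
    assume "l \<subseteq> A"
    then show "\<forall>E \<in> Gamma_planes. l \<subseteq> E"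
      by (auto simp: Gamma_planes_def pl_def A_def assms)
  qed
  have uniq: "l = A" if "l \<in> lines" "\<forall>E \<in> Gamma_planes. l \<subseteq> E" for l :: "'a vec4 set"
    using that sub dim unfolding G lines_def
    by (intro vec.subspace_dim_equal) auto
  have ok: "A \<in> lines \<and> (\<forall>E \<in> Gamma_planes. A \<subseteq> E)"
    using sub dim by (auto simp: G lines_def)
  show "\<exists>!l::'a vec4 set. l \<in> lines \<and> (\<forall>E \<in> Gamma_planes. l \<subseteq> E)"
  proof (rule ex1I)
    show "A \<in> lines \<and> (\<forall>E \<in> Gamma_planes. A \<subseteq> E)" by (rule ok)
  next
    fix l :: "'a vec4 set" assume "l \<in> lines \<and> (\<forall>E \<in> Gamma_planes. l \<subseteq> E)"
    then show "l = A" by (intro uniq) simp_all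
  qed
  have "Gamma_axis = A"
    unfolding Gamma_axis_def
  proof (rule the_equality)
    show "A \<in> lines \<and> (\<forall>E \<in> Gamma_planes. A \<subseteq> E)" by (rule ok)
  next
    fix l :: "'a vec4 set" assume "l \<in> lines \<and> (\<forall>E \<in> Gamma_planes. l \<subseteq> E)"
    then show "l = A" by (intro uniq) simp_all
  qed
  then show "(Gamma_axis::'a vec4 set) \<in> lines" "(Gamma_axis::'a vec4 set) = {x. x$0 = 0 \<and> x$3 = 0}"
    using ok by (simp_all add: A_def)
qed

end

theory Submission
  imports Defs "HOL-Number_Theory.Residues"
begin

text \<open>In characteristic 3 the planes of the pencil through the axis \<open>x\<^sub>0 = x\<^sub>3 = 0\<close> are exactly the
  \<open>\<Gamma>\<close>-planes, because cubing is a bijection of the field; each of them contains exactly one point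
  of the cubic, and this point is off the axis. So a line meeting the axis lies in exactly one
  \<open>\<Gamma>\<close>-plane, the one it spans with the axis, and inside a \<open>\<Gamma>\<close>-plane the EA-lines are the lines
  that avoid its point of the cubic, except for the axis: \<open>q\<^sup>2 - 1\<close> lines.\<close>

section \<open>Lines and planes\<close>

lemma dim_4: "vec.dim (UNIV :: 'a::field vec4 set) = 4"
  by (simp add: vec_dim_card del: vec.dim_UNIV)

lemma span_singleton_subset_iff:
  assumes "vec.subspace V"
  shows "vec.span {x} \<subseteq> V \<longleftrightarrow> x \<in> V"
  using assms by (metis insert_subset empty_subsetI vec.span_base vec.span_minimal singletonI subsetD)

lemma dim_psubset_subspace:
  fixes U V :: "'a::field vec4 set"
  assumes "vec.subspace U" "vec.subspace V" "U \<subset> V"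
  shows "vec.dim U < vec.dim V"
  using assms vec.subspace_dim_equal[of U V] by (metis not_le psubset_eq)

lemma span_pair_line:
  fixes x y :: "'a::field vec4"
  assumes "l \<in> lines" "x \<in> l" "y \<in> l" "x \<noteq> 0" "y \<notin> vec.span {x}"
  shows "vec.span {x, y} = l"
proof (rule vec.subspace_dim_equal)
  have ind: "vec.independent {y, x}"
    using assms by (simp add: vec.independent_insert)
  have "y \<noteq> x" using assms(5) by (auto simp: vec.span_base)
  then have "vec.dim (vec.span {x, y}) = 2"
    using vec.dim_span_eq_card_independent[OF ind] by (simp add: insert_commute)
  then show "vec.dim l \<le> vec.dim (vec.span {x, y})"
    using assms(1) by (simp add: lines_def)
  show "vec.span {x, y} \<subseteq> l"
    using assms by (intro vec.span_minimal) (auto simp: lines_def)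
qed (use assms in \<open>auto simp: lines_def\<close>)

text \<open>The dimensions of \<open>l\<close> and \<open>m\<close> add up to 4 while
  \<open>l + m\<close> stays inside a space of dimension 3, so the intersection has positive
  dimension. Inside a Gamma-plane this makes every line meet the axis.\<close>

lemma coplanar_lines_meet:
  fixes l m :: "'a::field vec4 set"
  assumes "l \<in> lines" "m \<in> lines" "E \<in> planes" "l \<subseteq> E" "m \<subseteq> E"
  obtains x where "x \<in> l" "x \<in> m" "x \<noteq> 0"
proof -
  have sub: "vec.subspace l" "vec.subspace m" "vec.subspace E"
    and dims: "vec.dim l = 2" "vec.dim m = 2" "vec.dim E = 3"
    using assms by (auto simp: lines_def planes_def)
  have "{x + y |x y. x \<in> l \<and> y \<in> m} \<subseteq> E"
  proof
    fix z assume "z \<in> {x + y |x y. x \<in> l \<and> y \<in> m}"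
    then obtain x y where "z = x + y" "x \<in> E" "y \<in> E"
      using assms(4,5) by blast
    then show "z \<in> E" using vec.subspace_add[OF sub(3)] by simp
  qed
  from vec.dim_subset[OF this] have "vec.dim (l \<inter> m) \<noteq> 0"
    using vec.dim_sums_Int[OF sub(1,2)] dims by linarith
  then have "\<not> l \<inter> m \<subseteq> {0}"
    by (metis vec.dim_eq_0)
  with that show thesis by blast
qed

text \<open>Adjoining \<open>v\<close> raises the dimension above 2, so the span already fills
  \<open>E\<close>. This serves both for a fixed reference line and for an arbitrary line avoiding
  \<open>v\<close>.\<close>

lemma span_insert_line_eq_plane:
  fixes l E :: "'a::field vec4 set"
  assumes "l \<in> lines" "l \<subseteq> E" "E \<in> planes" "v \<in> E" "v \<notin> l"
  shows "vec.span (insert v l) = E"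
proof (rule vec.subspace_dim_equal)
  have sub: "vec.subspace l" "vec.subspace E" and dims: "vec.dim l = 2" "vec.dim E = 3"
    using assms by (auto simp: lines_def planes_def)
  have "l \<subset> vec.span (insert v l)"
    using assms(5) vec.span_superset[of "insert v l"] by blast
  from dim_psubset_subspace[OF sub(1) _ this]
  show "vec.dim E \<le> vec.dim (vec.span (insert v l))"
    using dims by (simp del: vec.dim_span)
  show "vec.span (insert v l) \<subseteq> E"
    using assms sub by (intro vec.span_minimal) auto
qed (use assms in \<open>auto simp: planes_def\<close>)

lemma span_singleton_in_points:
  fixes x :: "'a::field vec4"
  assumes "x \<noteq> 0"
  shows "vec.span {x} \<in> points"
  using assms vec.dim_span_eq_card_independent[of "{x}"]
  by (simp add: points_def vec.independent_insert)

lemma point_nonzero: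
  fixes p :: "'a::field vec4 set"
  assumes "p \<in> points"
  obtains x where "x \<in> p" "x \<noteq> 0"
proof -
  have "\<not> p \<subseteq> {0}"
    using assms vec.dim_eq_0[of p] by (simp add: points_def)
  with that show thesis by blast
qed

text \<open>If \<open>e\<close>, \<open>f\<close> span \<open>A\<close>, a line of \<open>E\<close> avoiding \<open>v\<close> meets \<open>e + \<langle>v\<rangle>\<close> and \<open>f + \<langle>v\<rangle>\<close> in
  one vector each, \<open>e + av\<close> and \<open>f + bv\<close>, and it is determined by \<open>(a, b)\<close>.\<close>

lemma card_lines_in_plane_avoiding:
  fixes v :: "'a::{field,finite} vec4"
  assumes A: "A \<in> lines" "A \<subseteq> E" and E: "E \<in> planes" and v: "v \<in> E" "v \<notin> A"
  shows "card {l \<in> lines. l \<subseteq> E \<and> v \<notin> l} = CARD('a)\<^sup>2"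
proof -
  have subE: "vec.subspace E" and dimE: "vec.dim E = 3"
    using E by (auto simp: planes_def)
  have dimA: "vec.dim A = 2"
    using A by (auto simp: lines_def)
  obtain B where B: "B \<subseteq> A" "vec.independent B" "A \<subseteq> vec.span B" "card B = 2"
    using vec.basis_exists[of A] dimA by metis
  then obtain e f where ef: "B = {e, f}"
    by (meson card_2_iff)
  have efE: "e \<in> E" "f \<in> E" using B ef A by auto
  define L where "L = (\<lambda>(a, b). vec.span {e + a *s v, f + b *s v})"
  have span_E: "vec.span (insert v A) = E"
    by (rule span_insert_line_eq_plane[OF A E v])
  \<comment> \<open>The three vectors recover \<open>e\<close>, \<open>f\<close> and
    \<open>v\<close>, hence span \<open>E\<close>; a spanning set with at most
    \<open>dim E = 3\<close> elements is a basis. The cardinality clause rules out coincidences in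
    the set notation, so that removing \<open>v\<close> really leaves two independent
    vectors.\<close>
  have basis: "vec.independent {v, e + a *s v, f + b *s v} \<and> card {v, e + a *s v, f + b *s v} = 3"
    for a b
  proof -
    let ?C = "{v, e + a *s v, f + b *s v}"
    have vC: "v \<in> vec.span ?C" "e + a *s v \<in> vec.span ?C" "f + b *s v \<in> vec.span ?C"
      by (auto intro: vec.span_base)
    then have "(e + a *s v) - a *s v \<in> vec.span ?C" "(f + b *s v) - b *s v \<in> vec.span ?C"
      by (meson vec.span_diff vec.span_scale)+
    then have "B \<subseteq> vec.span ?C" using ef by simp
    then have "A \<subseteq> vec.span ?C"
      using B(3) vec.span_minimal[of B "vec.span ?C"] by auto
    then have span_C: "E \<subseteq> vec.span ?C"
      unfolding span_E[symmetric] using vC by (intro vec.span_minimal) auto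
    have C_E: "?C \<subseteq> E"
      using v efE subE by (auto intro: vec.subspace_add vec.subspace_scale)
    have le: "card ?C \<le> 3"
      by (simp add: card_insert_if)
    have "vec.independent ?C"
      using vec.card_le_dim_spanning[OF C_E span_C] le dimE by simp
    moreover from vec.basis_card_eq_dim[OF C_E span_C this] have "card ?C = 3"
      using dimE by simp
    ultimately show ?thesis ..
  qed
  have L_dim: "vec.dim (L (a, b)) = 2" and v_notin: "v \<notin> L (a, b)" for a b
  proof -
    have ne: "v \<noteq> e + a *s v" "v \<noteq> f + b *s v" "e + a *s v \<noteq> f + b *s v"
      using basis[of a b] by (auto simp: card_insert_if split: if_splits)
    then have nv: "v \<notin> {e + a *s v, f + b *s v}" by blast
    have ind: "vec.independent {e + a *s v, f + b *s v}" "v \<notin> vec.span {e + a *s v, f + b *s v}"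
      using basis[of a b] nv vec.independent_insert[of v "{e + a *s v, f + b *s v}"]
      by metis+
    show "v \<notin> L (a, b)" using ind(2) by (simp add: L_def)
    show "vec.dim (L (a, b)) = 2"
      using vec.dim_span_eq_card_independent[OF ind(1)] ne(3)
      unfolding L_def by simp
  qed
  have L_sub: "vec.subspace (L ab)" for ab
    by (simp add: L_def split: prod.split)
  have L_mem: "e + a *s v \<in> L (a, b)" "f + b *s v \<in> L (a, b)" for a b
    by (auto simp: L_def intro: vec.span_base)
  \<comment> \<open>Two different translates of \<open>x\<close> by multiples of \<open>v\<close> in
    \<open>L c\<close> would differ by a nonzero multiple of \<open>v\<close>, forcing
    \<open>v\<close> into \<open>L c\<close>. Applied to \<open>e\<close> and \<open>f\<close>, this
    makes \<open>L\<close> injective.\<close>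
  have coeff_eq: "a = a'"
    if "x + a *s v \<in> L c" "x + a' *s v \<in> L c" for x a a' c
  proof (rule ccontr)
    assume "a \<noteq> a'"
    have "(x + a *s v) - (x + a' *s v) \<in> L c"
      using that by (rule vec.subspace_diff[OF L_sub])
    also have "(x + a *s v) - (x + a' *s v) = (a - a') *s v"
      by (simp add: vec.scale_left_diff_distrib)
    finally have "inverse (a - a') *s ((a - a') *s v) \<in> L c"
      by (rule vec.subspace_scale[OF L_sub])
    moreover have "inverse (a - a') *s ((a - a') *s v) = v"
      unfolding vec.scale_scale using \<open>a \<noteq> a'\<close> by simp
    ultimately have "v \<in> L c" by simp
    then show False using v_notin by (metis surj_pair)
  qed
  have "bij_betw L UNIV {l \<in> lines. l \<subseteq> E \<and> v \<notin> l}"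
    unfolding bij_betw_def
  proof (intro conjI)
    show "inj L"
      by (rule injI) (metis L_mem coeff_eq surj_pair)
    show "range L = {l \<in> lines. l \<subseteq> E \<and> v \<notin> l}"
    proof
      have "L (a, b) \<subseteq> E" for a b
        unfolding L_def prod.case using v efE subE
        by (intro vec.span_minimal) (auto intro: vec.subspace_add vec.subspace_scale)
      then show "range L \<subseteq> {l \<in> lines. l \<subseteq> E \<and> v \<notin> l}"
        using L_sub L_dim v_notin by (auto simp: lines_def)
      show "{l \<in> lines. l \<subseteq> E \<and> v \<notin> l} \<subseteq> range L"
      proof
        fix l assume "l \<in> {l \<in> lines. l \<subseteq> E \<and> v \<notin> l}"
        then have l: "vec.subspace l" "vec.dim l = 2" "l \<subseteq> E" "v \<notin> l"
          by (auto simp: lines_def)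
        have "vec.span (insert v l) = E"
          using l E v(1) by (intro span_insert_line_eq_plane) (simp_all add: lines_def)
        \<comment> \<open>As \<open>x\<close> lies in the span of \<open>v\<close> and
          \<open>l\<close>, some \<open>x - k *s v\<close> lies in \<open>l\<close>; take
          \<open>a = - k\<close>.\<close>
        then have shift: "\<exists>a. x + a *s v \<in> l" if "x \<in> E" for x
          using that vec.span_breakdown_eq[of x v l] l(1)
          by (metis vec.span_eq_iff diff_conv_add_uminus vec.scale_minus_left)
        obtain a b where ab: "e + a *s v \<in> l" "f + b *s v \<in> l"
          using shift efE by blast
        have "L (a, b) = l"
        proof (rule vec.subspace_dim_equal)
          show "L (a, b) \<subseteq> l"
            unfolding L_def prod.case using ab l(1) by (intro vec.span_minimal) auto
        qed (use l L_sub L_dim in auto)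
        then show "l \<in> range L" by blast
      qed
    qed
  qed
  from bij_betw_same_card[OF this] show ?thesis
    by (simp add: card_prod power2_eq_square flip: UNIV_Times_UNIV)
qed

section \<open>The pencil of planes through the axis\<close>

lemma three_eq_0_if_card_power:
  assumes "CARD('a::{field,finite}) = 3 ^ h"
  shows "(3::'a) = 0"
proof -
  have "(of_nat (3 ^ h) :: 'a) = 0"
    using CHAR_dvd_CARD[where 'a='a] assms by (metis of_nat_eq_0_iff_char_dvd)
  then show ?thesis by simp
qed

text \<open>Cubing is the Frobenius map: \<open>x ^ 3 - y ^ 3\<close> and \<open>(x - y) ^ 3\<close>
  differ by a multiple of 3, and a field has no nonzero nilpotents.\<close>

lemma power3_eq_iff_char_3:
  fixes x y :: "'a::field"
  assumes "(3::'a) = 0"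
  shows "x ^ 3 = y ^ 3 \<longleftrightarrow> x = y"
proof -
  have "x ^ 3 - y ^ 3 = (x - y) ^ 3 + 3 * (x * y * (x - y))"
    by (simp add: power3_eq_cube algebra_simps)
  then have "x ^ 3 - y ^ 3 = (x - y) ^ 3"
    by (simp add: assms)
  then show ?thesis
    by (metis eq_iff_diff_eq_0 power_eq_0_iff zero_less_numeral zero_neq_numeral)
qed

lemma surj_power3_char_3:
  assumes "(3::'a::{field,finite}) = 0"
  shows "surj (\<lambda>t::'a. t ^ 3)"
  by (intro finite_UNIV_inj_surj) (auto intro: injI simp: power3_eq_iff_char_3[OF assms])

lemma mk_vec_nth [simp]:
  "mk_vec a b c d $ 0 = a" "mk_vec a b c d $ 1 = b" "mk_vec a b c d $ 2 = c" "mk_vec a b c d $ 3 = d"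
  by (simp_all add: mk_vec_def)

lemma subspace_pl: "vec.subspace (pl a b c d)"
proof (rule vec.subspaceI)
  show "0 \<in> pl a b c d"
    by (simp add: pl_def)
next
  fix x y assume "x \<in> pl a b c d" "y \<in> pl a b c d"
  moreover have "a * (x + y)$0 + b * (x + y)$1 + c * (x + y)$2 + d * (x + y)$3 =
      (a * x$0 + b * x$1 + c * x$2 + d * x$3) + (a * y$0 + b * y$1 + c * y$2 + d * y$3)"
    by (simp add: algebra_simps)
  ultimately show "x + y \<in> pl a b c d"
    unfolding pl_def by simp
next
  fix r x assume "x \<in> pl a b c d"
  moreover have "a * (r *s x)$0 + b * (r *s x)$1 + c * (r *s x)$2 + d * (r *s x)$3 =
      r * (a * x$0 + b * x$1 + c * x$2 + d * x$3)"
    by (simp add: algebra_simps)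
  ultimately show "r *s x \<in> pl a b c d"
    unfolding pl_def by simp
qed

text \<open>The two middle coefficients are multiples of 3 and vanish, so only the ratio of the
  outer coordinates is constrained; this displays the planes as members of the pencil on
  \<open>x$0 = x$3 = 0\<close>.\<close>

lemma Gamma_planes_char_3:
  assumes "(3::'a::field) = 0"
  shows "(Gamma_planes :: 'a vec4 set set) =
    insert {x. x$3 = 0} (range (\<lambda>t. {x. x$0 = t ^ 3 * x$3}))"
  by (auto simp: Gamma_planes_def pl_def assms)

lemma subspace_Gamma_plane: "E \<in> Gamma_planes \<Longrightarrow> vec.subspace E"
  by (auto simp: Gamma_planes_def subspace_pl)

lemma Gamma_axis_subset:
  assumes "(3::'a::field) = 0" "E \<in> (Gamma_planes :: 'a vec4 set set)"
  shows "Gamma_axis \<subseteq> E"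
  using assms by (auto simp: Gamma_axis_char_3(3) Gamma_planes_char_3)

text \<open>Off the axis the outer coordinates are not both 0. If \<open>w $ 3 = 0\<close>, only the
  plane \<open>x$3 = 0\<close> contains \<open>w\<close>; otherwise the parameter must be the unique
  cube root of \<open>w $ 0 / w $ 3\<close>.\<close>

lemma ex1_Gamma_plane_through:
  fixes w :: "'a::{field,finite} vec4"
  assumes char: "(3::'a) = 0" and w: "w \<notin> Gamma_axis"
  shows "\<exists>!E. E \<in> Gamma_planes \<and> w \<in> E"
proof (cases "w $ 3 = 0")
  case True
  then show ?thesis
    using w by (auto simp: Gamma_planes_char_3[OF char] Gamma_axis_char_3(3)[OF char])
next
  case False
  obtain t where t: "w $ 0 / w $ 3 = t ^ 3"
    using surj_power3_char_3[OF char] by (metis surjD)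
  have "w $ 0 = s ^ 3 * w $ 3 \<longleftrightarrow> s = t" for s
  proof -
    have "w $ 0 = s ^ 3 * w $ 3 \<longleftrightarrow> s ^ 3 = t ^ 3"
      using False t by (metis nonzero_eq_divide_eq)
    then show ?thesis by (simp add: power3_eq_iff_char_3[OF char])
  qed
  then show ?thesis
    using False by (auto simp: Gamma_planes_char_3[OF char])
qed

text \<open>The dimension is squeezed strictly between 2 and 4: one witness lies in \<open>E\<close>
  but off the axis, another lies outside \<open>E\<close>.\<close>

lemma Gamma_planes_subset_planes:
  assumes char: "(3::'a::{field,finite}) = 0"
  shows "(Gamma_planes :: 'a vec4 set set) \<subseteq> planes"
proof
  fix E :: "'a vec4 set" assume E: "E \<in> Gamma_planes"
  have axis: "vec.subspace (Gamma_axis :: 'a vec4 set)" "vec.dim (Gamma_axis :: 'a vec4 set) = 2"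
    using Gamma_axis_char_3(2)[OF char] by (auto simp: lines_def)
  consider (inf) "E = {x. x$3 = 0}" | (fin) t where "E = {x. x$0 = t ^ 3 * x$3}"
    using E by (auto simp: Gamma_planes_char_3[OF char])
  then have "\<exists>x y. x \<in> E \<and> y \<notin> E \<and> x \<notin> (Gamma_axis :: 'a vec4 set)"
  proof cases
    case inf
    then have "mk_vec 1 0 0 0 \<in> E" "mk_vec 0 0 0 1 \<notin> E" by simp_all
    moreover have "mk_vec 1 0 0 0 \<notin> (Gamma_axis :: 'a vec4 set)"
      by (simp add: Gamma_axis_char_3(3)[OF char])
    ultimately show ?thesis by blast
  next
    case fin
    then have "mk_vec (t ^ 3) 0 0 1 \<in> E" "mk_vec 1 0 0 0 \<notin> E" by simp_all
    moreover have "mk_vec (t ^ 3) 0 0 1 \<notin> (Gamma_axis :: 'a vec4 set)"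
      by (simp add: Gamma_axis_char_3(3)[OF char])
    ultimately show ?thesis by blast
  qed
  then obtain x y where "x \<in> E" "y \<notin> E" "x \<notin> (Gamma_axis :: 'a vec4 set)" by blast
  then have "Gamma_axis \<subset> E" "E \<subset> UNIV"
    using Gamma_axis_subset[OF char E] by auto
  then have "2 < vec.dim E" "vec.dim E < 4"
    using dim_psubset_subspace[OF axis(1) subspace_Gamma_plane[OF E]]
      dim_psubset_subspace[OF subspace_Gamma_plane[OF E] vec.subspace_UNIV]
      axis(2) dim_4[where 'a='a] by auto
  then show "E \<in> planes"
    using subspace_Gamma_plane[OF E] by (simp add: planes_def)
qed

text \<open>Choose \<open>w\<close> in \<open>E\<close> off the axis and a Gamma-plane
  \<open>F\<close> through \<open>w\<close>. Then \<open>E\<close> and \<open>F\<close> share the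
  axis and \<open>w\<close>, hence a subspace of dimension at least 3, and must coincide.\<close>

lemma plane_through_axis_is_Gamma:
  fixes E :: "'a::{field,finite} vec4 set"
  assumes char: "(3::'a) = 0" and E: "E \<in> planes" "Gamma_axis \<subseteq> E"
  shows "E \<in> Gamma_planes"
proof -
  have axis: "vec.subspace (Gamma_axis :: 'a vec4 set)" "vec.dim (Gamma_axis :: 'a vec4 set) = 2"
    using Gamma_axis_char_3(2)[OF char] by (auto simp: lines_def)
  have subE: "vec.subspace E" "vec.dim E = 3"
    using E by (auto simp: planes_def)
  have "Gamma_axis \<noteq> E"
    using axis subE by (metis numeral_eq_iff semiring_norm(89))
  with E obtain w where w: "w \<in> E" "w \<notin> Gamma_axis" by blast
  obtain F where F: "F \<in> Gamma_planes" "w \<in> F"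
    using ex1_Gamma_plane_through[OF char w(2)] by blast
  have subF: "vec.subspace F" "vec.dim F = 3"
    using F(1) Gamma_planes_subset_planes[OF char] by (auto simp: planes_def)
  have "Gamma_axis \<subset> E \<inter> F"
    using Gamma_axis_subset[OF char F(1)] E w F by blast
  then have dim: "3 \<le> vec.dim (E \<inter> F)"
    using dim_psubset_subspace[OF axis(1) vec.subspace_inter[OF subE(1) subF(1)]] axis(2) by simp
  then have "E \<inter> F = E" "E \<inter> F = F"
    using vec.subspace_dim_equal[OF vec.subspace_inter[OF subE(1) subF(1)]] subE subF by simp_all
  then show ?thesis using F by simp
qed

lemma card_Gamma_planes:
  assumes char: "(3::'a::{field,finite}) = 0"
  shows "card (Gamma_planes :: 'a vec4 set set) = CARD('a) + 1"
proof -
  \<comment> \<open>Vectors with outer coordinates \<open>(s ^ 3, 1)\<close> and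
    \<open>(1, 0)\<close> tell the members of the pencil apart.\<close>
  let ?E = "\<lambda>t::'a. {x :: 'a vec4. x$0 = t ^ 3 * x$3}"
  have "inj ?E"
  proof (rule injI)
    fix s t assume "?E s = ?E t"
    moreover have "mk_vec (s ^ 3) 0 0 1 \<in> ?E s" by simp
    ultimately have "mk_vec (s ^ 3) 0 0 1 \<in> ?E t" by metis
    then show "s = t" by (simp add: power3_eq_iff_char_3[OF char])
  qed
  moreover have "{x. x$3 = 0} \<noteq> ?E t" for t
  proof
    assume "{x. x$3 = 0} = ?E t"
    moreover have "mk_vec 1 0 0 0 \<in> {x :: 'a vec4. x$3 = 0}" by simp
    ultimately have "mk_vec 1 0 0 0 \<in> ?E t" by metis
    then show False by simp
  qed
  ultimately show ?thesis
    unfolding Gamma_planes_char_3[OF char]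
    by (subst card_insert_disjoint) (auto simp: card_image)
qed

lemma Gamma_plane_Int_twisted_cubic:
  fixes E :: "'a::field vec4 set"
  assumes char: "(3::'a) = 0" and E: "E \<in> Gamma_planes"
  obtains v where "v \<in> E" "v \<notin> Gamma_axis" "{p \<in> twisted_cubic. p \<subseteq> E} = {vec.span {v}}"
proof -
  have pt: "pt a b c d \<subseteq> E \<longleftrightarrow> mk_vec a b c d \<in> E" for a b c d
    unfolding pt_def by (rule span_singleton_subset_iff[OF subspace_Gamma_plane[OF E]])
  consider (inf) "E = {x. x$3 = 0}" | (fin) t where "E = {x. x$0 = t ^ 3 * x$3}"
    using E by (auto simp: Gamma_planes_char_3[OF char])
  then show thesis
  proof cases
    case inf
    then have mem: "w \<in> E \<longleftrightarrow> w $ 3 = 0" for w by simp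
    have "pt 1 0 0 0 \<subseteq> E" "\<not> pt (s ^ 3) (s ^ 2) s 1 \<subseteq> E" for s
      by (simp_all add: pt mem)
    then have "{p \<in> twisted_cubic. p \<subseteq> E} = {pt 1 0 0 0}"
      unfolding twisted_cubic_def by blast
    then show thesis
      \<comment> \<open>The rotation puts the equation between sets first, so that unification with
        it fixes \<open>v\<close> before the two membership conditions are checked.\<close>
      unfolding pt_def by (rule that[rotated 2]) (simp_all add: mem Gamma_axis_char_3(3)[OF char])
  next
    case fin
    then have mem: "w \<in> E \<longleftrightarrow> w $ 0 = t ^ 3 * w $ 3" for w by simp
    \<comment> \<open>The cubic point with parameter \<open>s\<close> lies on \<open>E\<close> iff
      \<open>s ^ 3 = t ^ 3\<close>, so injectivity of cubing leaves only
      \<open>s = t\<close>.\<close>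
    have "\<not> pt 1 0 0 0 \<subseteq> E" "pt (t ^ 3) (t ^ 2) t 1 \<subseteq> E"
      "pt (s ^ 3) (s ^ 2) s 1 \<subseteq> E \<Longrightarrow> s = t" for s
      by (simp_all add: pt mem power3_eq_iff_char_3[OF char])
    then have "{p \<in> twisted_cubic. p \<subseteq> E} = {pt (t ^ 3) (t ^ 2) t 1}"
      unfolding twisted_cubic_def by blast
    then show thesis
      unfolding pt_def by (rule that[rotated 2]) (simp_all add: mem Gamma_axis_char_3(3)[OF char])
  qed
qed

section \<open>EA-lines\<close>

text \<open>Inside \<open>E\<close> the conditions on an EA-line simplify: the only cubic point to
  avoid is the one spanned by \<open>v\<close>, and meeting the axis is automatic by
  \<open>coplanar_lines_meet\<close>.\<close>

lemma Lambda_EA_lines_Gamma_plane: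
  fixes E :: "'a::{field,finite} vec4 set"
  assumes char: "(3::'a) = 0" and E: "E \<in> Gamma_planes"
  shows "Lambda EA_lines E = CARD('a)\<^sup>2 - 1"
proof -
  obtain v where v: "v \<in> E" "v \<notin> Gamma_axis" "{p \<in> twisted_cubic. p \<subseteq> E} = {vec.span {v}}"
    using Gamma_plane_Int_twisted_cubic[OF char E] .
  note axis = Gamma_axis_char_3(2)[OF char] Gamma_axis_subset[OF char E]
  have plane: "E \<in> planes"
    using E Gamma_planes_subset_planes[OF char] by blast
  let ?S = "{l \<in> lines. l \<subseteq> E \<and> v \<notin> l}"
  have "{l \<in> EA_lines. l \<subseteq> E} = ?S - {Gamma_axis}"
  proof -
    have "(\<forall>p \<in> twisted_cubic. \<not> p \<subseteq> l) \<longleftrightarrow> v \<notin> l" if "l \<in> lines" "l \<subseteq> E" for l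
    proof -
      have "(\<forall>p \<in> twisted_cubic. \<not> p \<subseteq> l) \<longleftrightarrow> \<not> vec.span {v} \<subseteq> l"
        using v(3) that(2) by blast
      then show ?thesis
        using that(1) by (simp add: span_singleton_subset_iff lines_def)
    qed
    moreover have "\<exists>p \<in> points. p \<subseteq> l \<and> p \<subseteq> Gamma_axis" if l: "l \<in> lines" "l \<subseteq> E" for l
    proof -
      obtain x where x: "x \<in> l" "x \<in> Gamma_axis" "x \<noteq> 0"
        using coplanar_lines_meet[OF l(1) axis(1) plane l(2) axis(2)] .
      then have "vec.span {x} \<subseteq> l" "vec.span {x} \<subseteq> Gamma_axis"
        using l(1) axis(1) by (auto simp: span_singleton_subset_iff lines_def)
      with span_singleton_in_points[OF x(3)] show ?thesis by blast
    qed
    ultimately show ?thesis by (auto simp: EA_lines_def)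
  qed
  \<comment> \<open>The axis is itself one of the counted lines avoiding \<open>v\<close>; removing
    it accounts for the subtracted 1.\<close>
  moreover have "Gamma_axis \<in> ?S"
    using axis v by simp
  ultimately show ?thesis
    unfolding Lambda_def
    using card_lines_in_plane_avoiding[OF axis plane v(1,2)] by simp
qed

text \<open>Write \<open>l\<close> as the span of \<open>x\<close> on the axis and \<open>w\<close>
  off it. Every Gamma-plane contains \<open>x\<close>, so whether it contains \<open>l\<close>
  depends on \<open>w\<close> alone.\<close>

lemma card_Gamma_planes_through_EA_line:
  fixes l :: "'a::{field,finite} vec4 set"
  assumes char: "(3::'a) = 0" and l: "l \<in> EA_lines"
  shows "card {E \<in> Gamma_planes. l \<subseteq> E} = 1"
proof -
  obtain p where line: "l \<in> lines" "l \<noteq> Gamma_axis"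
    and p: "p \<in> points" "p \<subseteq> l" "p \<subseteq> Gamma_axis"
    using l by (auto simp: EA_lines_def)
  obtain x where x: "x \<in> p" "x \<noteq> 0" using point_nonzero[OF p(1)] .
  have axis: "vec.subspace (Gamma_axis :: 'a vec4 set)" "vec.dim (Gamma_axis :: 'a vec4 set) = 2"
    using Gamma_axis_char_3(2)[OF char] by (auto simp: lines_def)
  have "\<not> l \<subseteq> Gamma_axis"
    using vec.subspace_dim_equal[of l Gamma_axis] axis line by (auto simp: lines_def)
  then obtain w where w: "w \<in> l" "w \<notin> Gamma_axis" by blast
  have "w \<notin> vec.span {x}"
    using w(2) x(1) p(3) span_singleton_subset_iff[OF axis(1), of x] by blast
  then have span: "vec.span {x, w} = l"
    using line(1) x p(2) w(1) by (intro span_pair_line) auto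
  have "l \<subseteq> E \<longleftrightarrow> w \<in> E" if E: "E \<in> Gamma_planes" for E
  proof
    assume "w \<in> E"
    moreover have "x \<in> E" using Gamma_axis_subset[OF char E] p(3) x(1) by blast
    ultimately show "l \<subseteq> E"
      unfolding span[symmetric] using subspace_Gamma_plane[OF E] by (intro vec.span_minimal) auto
  qed (use w in blast)
  then have "{E \<in> Gamma_planes. l \<subseteq> E} = {E \<in> Gamma_planes. w \<in> E}" by blast
  moreover obtain F where "{E \<in> Gamma_planes. w \<in> E} = {F}"
    using ex1_Gamma_plane_through[OF char w(2)] by blast
  ultimately show ?thesis by simp
qed

section \<open>Assembly of the incidence numbers\<close>

theorem theorem6p1:
  fixes q h :: nat
  assumes "q = CARD('a::{field,finite})" and "q = 3 ^ h" and "q \<ge> 5"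
  shows "(\<forall>E \<in> (Gamma_planes :: 'a vec4 set set). Gamma_axis \<subseteq> E)
    \<and> (\<forall>E \<in> (Gamma_planes :: 'a vec4 set set). Lambda {Gamma_axis} E = 1)
    \<and> Pi_avg (Gamma_planes :: 'a vec4 set set) {Gamma_axis} = real q + 1
    \<and> (\<forall>E \<in> (cubic_planes 2 \<union> cubic_planes 3 \<union> one_bar_planes \<union> cubic_planes 0 :: 'a vec4 set set).
          \<not> Gamma_axis \<subseteq> E)
    \<and> (\<forall>E \<in> (Gamma_planes :: 'a vec4 set set). Lambda EA_lines E = q\<^sup>2 - 1)
    \<and> Pi_avg (Gamma_planes :: 'a vec4 set set) EA_lines = 1"
proof (intro conjI ballI)
  have char: "(3::'a) = 0"
    by (rule three_eq_0_if_card_power[OF trans[OF assms(1)[symmetric] assms(2)]])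
  show axis: "Gamma_axis \<subseteq> E" if "E \<in> Gamma_planes" for E :: "'a vec4 set"
    using Gamma_axis_subset[OF char that] .
  show "Lambda {Gamma_axis} E = 1" if "E \<in> Gamma_planes" for E :: "'a vec4 set"
  proof -
    have "{l \<in> {Gamma_axis}. l \<subseteq> E} = {Gamma_axis}"
      using axis[OF that] by blast
    then show ?thesis by (simp add: Lambda_def)
  qed
  have "{E \<in> Gamma_planes. Gamma_axis \<subseteq> E} = (Gamma_planes :: 'a vec4 set set)"
    using axis by blast
  then show "Pi_avg (Gamma_planes :: 'a vec4 set set) {Gamma_axis} = real q + 1"
    by (simp add: Pi_avg_def card_Gamma_planes[OF char] assms(1))
  show "\<not> Gamma_axis \<subseteq> E"
    if E: "E \<in> cubic_planes 2 \<union> cubic_planes 3 \<union> one_bar_planes \<union> cubic_planes 0"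
    for E :: "'a vec4 set"
  proof
    assume "Gamma_axis \<subseteq> E"
    moreover have "E \<in> planes"
      using E by (auto simp: cubic_planes_def one_bar_planes_def)
    ultimately have Gamma: "E \<in> Gamma_planes"
      by (intro plane_through_axis_is_Gamma[OF char])
    obtain v where "{p \<in> twisted_cubic. p \<subseteq> E} = {vec.span {v}}"
      using Gamma_plane_Int_twisted_cubic[OF char Gamma] .
    then have "card {p \<in> twisted_cubic. p \<subseteq> E} = 1" by simp
    then have "E \<notin> cubic_planes d" if "d \<noteq> 1" for d
      using that unfolding cubic_planes_def by simp
    from this[of 0] this[of 2] this[of 3] E Gamma show False
      unfolding one_bar_planes_def by simp
  qed
  show Lambda_EA: "Lambda EA_lines E = q\<^sup>2 - 1" if "E \<in> Gamma_planes" for E :: "'a vec4 set"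
    using Lambda_EA_lines_Gamma_plane[OF char that] by (simp add: assms(1))
  \<comment> \<open>The average would be 0/0 = 0 rather than 1 if there were no EA-lines. One
    Gamma-plane already contains \<open>q\<^sup>2 - 1\<close> of them, and this natural-number
    difference is positive since \<open>q \<ge> 5\<close>.\<close>
  have "pl 0 0 0 1 \<in> (Gamma_planes :: 'a vec4 set set)"
    unfolding Gamma_planes_def by (rule insertI1)
  then have "Lambda EA_lines (pl 0 0 0 1 :: 'a vec4 set) = q\<^sup>2 - 1"
    by (rule Lambda_EA)
  moreover have "1 < q\<^sup>2"
    using \<open>q \<ge> 5\<close> by (intro one_less_power) simp_all
  ultimately have "Lambda EA_lines (pl 0 0 0 1 :: 'a vec4 set) \<noteq> 0"
    by linarith
  moreover have "Lambda {} (pl 0 0 0 1 :: 'a vec4 set) = 0"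
    by (simp add: Lambda_def)
  ultimately have "(EA_lines :: 'a vec4 set set) \<noteq> {}"
    by metis
  then have "card (EA_lines :: 'a vec4 set set) \<noteq> 0"
    by simp
  then show "Pi_avg (Gamma_planes :: 'a vec4 set set) EA_lines = 1"
    unfolding Pi_avg_def by (simp add: card_Gamma_planes_through_EA_line[OF char] del: card_0_eq)
qed

end
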